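(* Let $0<\epsilon<\delta$, let $f\in V'$ and $g\in V_\Gamma$. Let $u\in V$ be the solution of $$\mathcal A(u,\varphi)=\mathcal F(\varphi)\quad\forall\,\varphi\in V_0,\qquad u=g \text{ in }\Gamma,$$ and let $u_\epsilon\in V$ be the solution of $$\mathcal A_\epsilon(u_\epsilon,\varphi)=\mathcal F(\varphi)\quad\forall\,\varphi\in V_0,\qquad u_\epsilon=g \text{ in }\Gamma.$$ Then $$\|u-u_\epsilon\|_{L^2(\Omega\cup\Gamma)}\le C_{eq}\,k(\epsilon)\,\|u_\epsilon\|_{L^2(\Omega\cup\Gamma)},\qquad k(\epsilon)=2c_1(\epsilon)+2c_2(\epsilon)\,|\Omega\cup\Gamma|^{1/2},$$ where $$c_1(\epsilon)=\max_{x\in\Omega\cup\Gamma}\int_{B_{\delta+\epsilon}(x)\cap(\Omega\cup\Gamma)}|\gamma_\epsilon(x,y)-\gamma(x,y)|\,dy,\qquad c_2(\epsilon)^2=\max_{x\in\Omega\cup\Gamma}\int_{B_{\delta+\epsilon}(x)\cap(\Omega\cup\Gamma)}(\gamma_\epsilon(x,y)-\gamma(x,y))^2\,dy,$$ and $k(\epsilon)\to0$ as $\epsilon\to0$ (with $\delta$ fixed).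
   Context: Let $n\in\{1,2,3\}$, let $\Omega\subset\mathbb R^n$ be open and bounded, let $\delta>0$, and let $\Gamma=\{y\in\mathbb R^n\setminus\Omega: |x-y|\le\delta\text{ for some }x\in\Omega\}$. $B_r(x)$ is the Euclidean ball of radius $r$ centered at $x$, and $|\Omega\cup\Gamma|$ is the Lebesgue measure of $\Omega\cup\Gamma$. Exact kernel: $\gamma(x,y)=C_\delta\,\eta(x,y)\,\mathcal X(y\in B_\delta(x))$, where $\mathcal X$ is the indicator function, $\eta(x,y)=\eta(|x-y|)$ is radial, nonnegative and smooth, so that $\gamma$ is an integrable, nonnegative, symmetric, radial kernel, and $C_\delta>0$ is a scaling constant (chosen so that the operator $\mathcal L u(x)=2\int_{\mathbb R^n}(u(y)-u(x))\gamma(x,y)\,dy$ converges to the Laplacian $\Delta$ as $\delta\to0$). Approximate kernel: for $0<\epsilon<\delta$, $\gamma_\epsilon(x,y)=C_{\delta,\epsilon}\,\eta(x,y)\,\mu_{\delta,\epsilon}(|x-y|)$, where $C_{\delta,\epsilon}$ is a scaling constant such that $C_{\delta,\epsilon}\to C_\delta$ as $\epsilon\to0$ (also chosen so that the operator associated with $\gamma_\epsilon$ converges to $\Delta$ as $\delta\to0$), and $$\mu_{\delta,\epsilon}(s)=\begin{cases}1 & 0\le s<\delta-\epsilon,\\ \xi\left(\frac{\delta-s}{\epsilon}\right) & \delta-\epsilon\le s\le\delta+\epsilon,\\ 0 & s>\delta+\epsilon,\end{cases}\qquad \xi(r)=\tfrac{1}{256}\left(128+315r-420r^3+378r^5-180r^7+35r^9\right).$$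 Forms: $$\mathcal A(u,\varphi)=\iint_{(\Omega\cup\Gamma)^2}(u(y)-u(x))(\varphi(y)-\varphi(x))\gamma(x,y)\,dy\,dx,$$ $\mathcal A_\epsilon$ is defined by the same formula with $\gamma_\epsilon$ in place of $\gamma$, and $\mathcal F(\varphi)=\int_\Omega f(x)\varphi(x)\,dx$ (understood as the duality pairing of $f\in V'$ with $\varphi$). Spaces: $|||\varphi|||^2=\mathcal A(\varphi,\varphi)$; $V=\{\varphi\in L^2(\Omega\cup\Gamma): |||\varphi|||<\infty\}$; $V_0=\{\varphi\in V:\varphi|_\Gamma=0\}$; $V_\Gamma=\{p:\Gamma\to\mathbb R:\ \exists\,\varphi\in V\text{ with }\varphi|_\Gamma=p\}$; $V'$ is the dual space of $V$. Standing assumption: for the kernels considered, $|||\cdot|||$ is a norm on $V_0$ equivalent to the $L^2(\Omega\cup\Gamma)$ norm; $C_{eq}>0$ denotes a constant such that $\|\varphi\|^2_{L^2(\Omega\cup\Gamma)}\le C_{eq}\,|||\varphi|||^2$ for all $\varphi\in V_0$. Both weak problems are well-posed. *)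

theory Defs
  imports "HOL-Analysis.Analysis"
begin

text \<open>Kernels.  Smoothness of the radial profile is one-sided at the origin, so it covers both a
  profile that is smooth on the closed half-line and one for which \<open>z \<mapsto> \<eta> (norm z)\<close> is smooth on the
  whole space.\<close>

definition smooth_profile :: "(real \<Rightarrow> real) \<Rightarrow> bool" where
  "smooth_profile \<eta> \<longleftrightarrow>
     (\<exists>D :: nat \<Rightarrow> real \<Rightarrow> real.
        (\<forall>r\<ge>0. D 0 r = \<eta> r) \<and>
        (\<forall>k. \<forall>r\<ge>0. (D k has_real_derivative D (Suc k) r) (at r within {0..})))"

definition interaction_domain :: "real \<Rightarrow> 'a::real_normed_vector set \<Rightarrow> 'a set" where
  "interaction_domain \<delta> \<Omega> = {y. y \<notin> \<Omega> \<and> (\<exists>x\<in>\<Omega>. norm (x - y) \<le> \<delta>)}"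

definition exact_kernel ::
  "real \<Rightarrow> (real \<Rightarrow> real) \<Rightarrow> real \<Rightarrow> 'a::real_normed_vector \<Rightarrow> 'a \<Rightarrow> real" where
  "exact_kernel C \<eta> \<delta> x y = C * \<eta> (norm (x - y)) * indicator (ball x \<delta>) y"

definition cutoff_poly :: "real \<Rightarrow> real" where
  "cutoff_poly r =
     (1 / 256) * (128 + 315 * r - 420 * r ^ 3 + 378 * r ^ 5 - 180 * r ^ 7 + 35 * r ^ 9)"

definition cutoff :: "real \<Rightarrow> real \<Rightarrow> real \<Rightarrow> real" where
  "cutoff \<delta> \<epsilon> s =
     (if s < \<delta> - \<epsilon> then 1
      else if s \<le> \<delta> + \<epsilon> then cutoff_poly ((\<delta> - s) / \<epsilon>)
      else 0)"

definition approx_kernel ::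
  "real \<Rightarrow> (real \<Rightarrow> real) \<Rightarrow> real \<Rightarrow> real \<Rightarrow> 'a::real_normed_vector \<Rightarrow> 'a \<Rightarrow> real" where
  "approx_kernel C \<eta> \<delta> \<epsilon> x y = C * \<eta> (norm (x - y)) * cutoff \<delta> \<epsilon> (norm (x - y))"

text \<open>Function spaces.  Elements are functions rather than classes modulo null sets; accordingly
  conditions on the interaction domain \<open>\<Gamma>\<close> are required almost everywhere.  Throughout, \<open>S\<close> is the
  set over which the forms are integrated.\<close>

definition L2_space :: "'a::euclidean_space set \<Rightarrow> ('a \<Rightarrow> real) set" where
  "L2_space S = {\<phi>. \<phi> \<in> borel_measurable (lebesgue_on S) \<and>
                    integrable (lebesgue_on S) (\<lambda>x. (\<phi> x)\<^sup>2)}"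

definition L2_norm_on :: "'a::euclidean_space set \<Rightarrow> ('a \<Rightarrow> real) \<Rightarrow> real" where
  "L2_norm_on S \<phi> = sqrt (\<integral>x. (\<phi> x)\<^sup>2 \<partial>lebesgue_on S)"

definition nonlocal_form ::
  "'a::euclidean_space set \<Rightarrow> ('a \<Rightarrow> 'a \<Rightarrow> real) \<Rightarrow> ('a \<Rightarrow> real) \<Rightarrow> ('a \<Rightarrow> real) \<Rightarrow> real" where
  "nonlocal_form S \<gamma> u \<phi> =
     (\<integral>x. (\<integral>y. (u y - u x) * (\<phi> y - \<phi> x) * \<gamma> x y \<partial>lebesgue_on S) \<partial>lebesgue_on S)"

definition energy_norm ::
  "'a::euclidean_space set \<Rightarrow> ('a \<Rightarrow> 'a \<Rightarrow> real) \<Rightarrow> ('a \<Rightarrow> real) \<Rightarrow> real" where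
  "energy_norm S \<gamma> \<phi> = sqrt (nonlocal_form S \<gamma> \<phi> \<phi>)"

text \<open>Finiteness of the energy is expressed with the extended nonnegative integral, because the
  Bochner integral in \<^const>\<open>nonlocal_form\<close> is \<open>0\<close> on non-integrable functions.\<close>

definition energy_space ::
  "'a::euclidean_space set \<Rightarrow> ('a \<Rightarrow> 'a \<Rightarrow> real) \<Rightarrow> ('a \<Rightarrow> real) set" where
  "energy_space S \<gamma> = {\<phi> \<in> L2_space S.
     (\<integral>\<^sup>+x. (\<integral>\<^sup>+y. ennreal ((\<phi> y - \<phi> x)\<^sup>2 * \<gamma> x y) \<partial>lebesgue_on S) \<partial>lebesgue_on S) < \<infinity>}"

definition constrained_space ::
  "'a::euclidean_space set \<Rightarrow> 'a set \<Rightarrow> ('a \<Rightarrow> 'a \<Rightarrow> real) \<Rightarrow> ('a \<Rightarrow> real) set" where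
  "constrained_space S \<Gamma> \<gamma> = {\<phi> \<in> energy_space S \<gamma>. AE x in lebesgue_on \<Gamma>. \<phi> x = 0}"

text \<open>Only the values of \<open>p\<close> on \<open>\<Gamma>\<close> matter.\<close>

definition trace_space ::
  "'a::euclidean_space set \<Rightarrow> 'a set \<Rightarrow> ('a \<Rightarrow> 'a \<Rightarrow> real) \<Rightarrow> ('a \<Rightarrow> real) set" where
  "trace_space S \<Gamma> \<gamma> = {p. \<exists>\<phi> \<in> energy_space S \<gamma>. AE x in lebesgue_on \<Gamma>. \<phi> x = p x}"

text \<open>The energy norm is only a seminorm on \<^term>\<open>energy_space S \<gamma>\<close> (it vanishes on constants), so
  continuity of functionals refers to the graph norm.  Functionals bounded by the energy norm alone
  or by the \<open>L\<^sup>2\<close> norm alone are included.  Boundedness and linearity make every functional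
  invariant under changes on null sets.\<close>

definition dual_space ::
  "'a::euclidean_space set \<Rightarrow> ('a \<Rightarrow> 'a \<Rightarrow> real) \<Rightarrow> (('a \<Rightarrow> real) \<Rightarrow> real) set" where
  "dual_space S \<gamma> = {F.
     (\<forall>\<phi>\<in>energy_space S \<gamma>. \<forall>\<psi>\<in>energy_space S \<gamma>. \<forall>a b :: real.
        F (\<lambda>x. a * \<phi> x + b * \<psi> x) = a * F \<phi> + b * F \<psi>) \<and>
     (\<exists>K. \<forall>\<phi>\<in>energy_space S \<gamma>.
        \<bar>F \<phi>\<bar> \<le> K * sqrt ((L2_norm_on S \<phi>)\<^sup>2 + (energy_norm S \<gamma> \<phi>)\<^sup>2))}"

text \<open>The spaces are always those of the kernel \<open>\<gamma>\<close>; the kernel \<open>\<kappa>\<close> of the form may be different.\<close>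

definition weak_solution ::
  "'a::euclidean_space set \<Rightarrow> 'a set \<Rightarrow> ('a \<Rightarrow> 'a \<Rightarrow> real) \<Rightarrow> ('a \<Rightarrow> 'a \<Rightarrow> real) \<Rightarrow>
   (('a \<Rightarrow> real) \<Rightarrow> real) \<Rightarrow> ('a \<Rightarrow> real) \<Rightarrow> ('a \<Rightarrow> real) \<Rightarrow> bool" where
  "weak_solution S \<Gamma> \<gamma> \<kappa> F g u \<longleftrightarrow>
     u \<in> energy_space S \<gamma> \<and>
     (\<forall>\<phi>\<in>constrained_space S \<Gamma> \<gamma>. nonlocal_form S \<kappa> u \<phi> = F \<phi>) \<and>
     (AE x in lebesgue_on \<Gamma>. u x = g x)"

text \<open>Error constants for kernels \<open>\<gamma>\<close>, \<open>\<kappa>\<close>, with \<open>R\<close> in the role of \<open>\<delta> + \<epsilon>\<close>.  Suprema are used since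
  \<open>S = \<Omega> \<union> \<Gamma>\<close> is open and a maximum need not be attained.\<close>

definition error_c1 ::
  "'a::euclidean_space set \<Rightarrow> real \<Rightarrow> ('a \<Rightarrow> 'a \<Rightarrow> real) \<Rightarrow> ('a \<Rightarrow> 'a \<Rightarrow> real) \<Rightarrow> real" where
  "error_c1 S R \<gamma> \<kappa> = (SUP x\<in>S. \<integral>y. \<bar>\<kappa> x y - \<gamma> x y\<bar> \<partial>lebesgue_on (ball x R \<inter> S))"

definition error_c2 ::
  "'a::euclidean_space set \<Rightarrow> real \<Rightarrow> ('a \<Rightarrow> 'a \<Rightarrow> real) \<Rightarrow> ('a \<Rightarrow> 'a \<Rightarrow> real) \<Rightarrow> real" where
  "error_c2 S R \<gamma> \<kappa> = sqrt (SUP x\<in>S. \<integral>y. (\<kappa> x y - \<gamma> x y)\<^sup>2 \<partial>lebesgue_on (ball x R \<inter> S))"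

definition error_k ::
  "'a::euclidean_space set \<Rightarrow> real \<Rightarrow> ('a \<Rightarrow> 'a \<Rightarrow> real) \<Rightarrow> ('a \<Rightarrow> 'a \<Rightarrow> real) \<Rightarrow> real" where
  "error_k S R \<gamma> \<kappa> =
     2 * error_c1 S R \<gamma> \<kappa> + 2 * error_c2 S R \<gamma> \<kappa> * sqrt (measure lebesgue S)"

end

theory Submission
  imports Defs
begin

text \<open>The error \<open>w = u - u\<^sub>\<epsilon>\<close> vanishes on \<open>\<Gamma>\<close> and hence is itself an admissible test function.  Testing
both problems with it and subtracting gives
\<open>\<A>(w, w) = \<F>(w) - \<A>(u\<^sub>\<epsilon>, w) = \<A>\<^sub>\<epsilon>(u\<^sub>\<epsilon>, w) - \<A>(u\<^sub>\<epsilon>, w)\<close>, the form of the kernel difference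
\<open>d = \<gamma>\<^sub>\<epsilon> - \<gamma>\<close> at \<open>(u\<^sub>\<epsilon>, w)\<close>.  This is the second Strang lemma without an approximation term, since the
two problems have the same test space.

It remains to bound the form of a bounded symmetric kernel \<open>d\<close> by \<open>k \<parallel>u\<parallel> \<parallel>w\<parallel>\<close> (\<open>form_bound\<close>).
Expanding \<open>(u y - u x) (w y - w x)\<close> gives two diagonal and two mixed terms, equal in pairs by symmetry.
In a diagonal term the integral of \<open>\<bar>d x y\<bar>\<close> over \<open>y\<close> splits off and is at most \<open>c\<^sub>1\<close>; in a mixed term
Cauchy-Schwarz in \<open>y\<close> yields \<open>\<parallel>u\<parallel> c\<^sub>2\<close>, and the remaining integral of \<open>\<bar>w\<bar>\<close> costs the square root of the
volume.  Coercivity then gives \<open>\<parallel>w\<parallel>\<^sup>2 \<le> C\<^sub>e\<^sub>q k \<parallel>u\<^sub>\<epsilon>\<parallel> \<parallel>w\<parallel>\<close>, and one factor \<open>\<parallel>w\<parallel>\<close> cancels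
(\<open>weak_solution_kernel_perturbation\<close>).

For \<open>k(\<epsilon>) \<longlongrightarrow> 0\<close>: the two kernels differ by at most a multiple of \<open>\<bar>C\<^sub>\<delta>\<^sub>\<epsilon> - C\<^sub>\<delta>\<bar>\<close> everywhere, and by a bounded
amount on the annulus \<open>\<delta> - \<epsilon> \<le> \<bar>x - y\<bar> \<le> \<delta> + \<epsilon>\<close> (\<open>kernel_difference_bound\<close>), whose volume tends to \<open>0\<close>
and does not depend on \<open>x\<close>.  This controls \<open>c\<^sub>1\<close> uniformly in \<open>x\<close>, and \<open>c\<^sub>2\<^sup>2\<close> is at most \<open>sup \<bar>d\<bar>\<close> times the
same bound (\<open>error_k_le\<close>).\<close>

section \<open>Square-integrable functions\<close>

definition square_integrable :: "'a measure \<Rightarrow> ('a \<Rightarrow> real) \<Rightarrow> bool" where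
  "square_integrable M f \<longleftrightarrow> f \<in> borel_measurable M \<and> integrable M (\<lambda>x. (f x)\<^sup>2)"

text \<open>On a finite measure space boundedness makes every integrand below integrable over the product, so that the iterated
Bochner integrals of the forms are genuine double integrals.\<close>

definition bounded_kernel :: "'a measure \<Rightarrow> ('a \<Rightarrow> 'a \<Rightarrow> real) \<Rightarrow> bool" where
  "bounded_kernel M \<kappa> \<longleftrightarrow> (\<lambda>(x, y). \<kappa> x y) \<in> borel_measurable (M \<Otimes>\<^sub>M M) \<and>
     (\<exists>B. \<forall>x\<in>space M. \<forall>y\<in>space M. \<bar>\<kappa> x y\<bar> \<le> B)"

lemma square_integrable_abs: "square_integrable M f \<Longrightarrow> square_integrable M (\<lambda>x. \<bar>f x\<bar>)"
  by (auto simp: square_integrable_def)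

lemma square_integrable_mult_integrable:
  assumes "square_integrable M f" "square_integrable M g"
  shows "integrable M (\<lambda>x. f x * g x)"
proof (rule Bochner_Integration.integrable_bound)
  show "integrable M (\<lambda>x. (f x)\<^sup>2 + (g x)\<^sup>2)"
    using assms by (simp add: square_integrable_def)
  show "(\<lambda>x. f x * g x) \<in> borel_measurable M"
    using assms by (auto simp: square_integrable_def)
  have "\<bar>a * b\<bar> \<le> a\<^sup>2 + b\<^sup>2" for a b :: real
    using sum_squares_bound[of "\<bar>a\<bar>" "\<bar>b\<bar>"] mult_nonneg_nonneg[of "\<bar>a\<bar>" "\<bar>b\<bar>"]
    by (simp add: abs_mult del: mult_nonneg_nonneg)
  then show "AE x in M. norm (f x * g x) \<le> norm ((f x)\<^sup>2 + (g x)\<^sup>2)"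
    by (simp add: real_norm_def)
qed

lemma square_integrable_diff:
  assumes "square_integrable M f" "square_integrable M g"
  shows "square_integrable M (\<lambda>x. f x - g x)"
  using assms square_integrable_mult_integrable[OF assms]
  by (auto simp: square_integrable_def power2_diff mult.assoc)

text \<open>Integrating the weighted inequality \<open>2 s t \<bar>f g\<bar> \<le> s\<^sup>2 f\<^sup>2 + t\<^sup>2 g\<^sup>2\<close> with \<open>s = \<parallel>g\<parallel> + e\<close> and \<open>t = \<parallel>f\<parallel> + e\<close>
makes the weights positive even if a norm vanishes; \<open>e\<close> then tends to \<open>0\<close>.\<close>

lemma Cauchy_Schwarz_integral:
  assumes f: "square_integrable M f" and g: "square_integrable M g"
  shows "(\<integral>x. \<bar>f x * g x\<bar> \<partial>M) \<le> sqrt (\<integral>x. (f x)\<^sup>2 \<partial>M) * sqrt (\<integral>x. (g x)\<^sup>2 \<partial>M)"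
proof -
  define a b where "a = sqrt (\<integral>x. (f x)\<^sup>2 \<partial>M)" and "b = sqrt (\<integral>x. (g x)\<^sup>2 \<partial>M)"
  have ab: "a \<ge> 0" "b \<ge> 0" "(\<integral>x. (f x)\<^sup>2 \<partial>M) = a\<^sup>2" "(\<integral>x. (g x)\<^sup>2 \<partial>M) = b\<^sup>2"
    by (auto simp: a_def b_def)
  have fg: "integrable M (\<lambda>x. \<bar>f x * g x\<bar>)"
    using square_integrable_mult_integrable[OF f g] by (rule integrable_abs)
  have "(\<integral>x. \<bar>f x * g x\<bar> \<partial>M) \<le> (a + e) * (b + e)" if "e > 0" for e
  proof -
    define s t where "s = b + e" and "t = a + e"
    have st: "s > 0" "t > 0" using ab that by (auto simp: s_def t_def)
    have "2 * s * t * \<bar>f x * g x\<bar> \<le> s\<^sup>2 * (f x)\<^sup>2 + t\<^sup>2 * (g x)\<^sup>2" for x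
      using zero_le_power2[of "s * \<bar>f x\<bar> - t * \<bar>g x\<bar>"]
      by (simp add: power2_diff abs_mult power_mult_distrib algebra_simps)
    then have "(\<integral>x. 2 * s * t * \<bar>f x * g x\<bar> \<partial>M) \<le> (\<integral>x. s\<^sup>2 * (f x)\<^sup>2 + t\<^sup>2 * (g x)\<^sup>2 \<partial>M)"
      using f g fg by (intro integral_mono) (auto simp: square_integrable_def)
    then have "2 * s * t * (\<integral>x. \<bar>f x * g x\<bar> \<partial>M) \<le> s\<^sup>2 * a\<^sup>2 + t\<^sup>2 * b\<^sup>2"
      using f g by (simp add: square_integrable_def ab)
    also have "\<dots> \<le> s\<^sup>2 * t\<^sup>2 + t\<^sup>2 * s\<^sup>2"
      using ab that by (intro add_mono mult_left_mono power_mono) (auto simp: s_def t_def)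
    also have "\<dots> = 2 * s * t * (t * s)" by (simp add: power2_eq_square)
    finally show ?thesis using st by (simp add: s_def t_def)
  qed
  then have "eventually (\<lambda>e. (\<integral>x. \<bar>f x * g x\<bar> \<partial>M) \<le> (a + e) * (b + e)) (at_right 0)"
    by (simp add: eventually_at_right_less eventually_mono[OF eventually_at_right_less])
  moreover have "((\<lambda>e. (a + e) * (b + e)) \<longlongrightarrow> (a + 0) * (b + 0)) (at_right 0)"
    by (intro tendsto_intros)
  ultimately show ?thesis
    using tendsto_lowerbound[of "\<lambda>e. (a + e) * (b + e)"] by (simp add: a_def b_def)
qed

section \<open>Forms of bounded kernels on a finite measure space\<close>

context finite_measure
begin

lemma pair_sigma_finite_self: "pair_sigma_finite M M"
  by (intro pair_sigma_finite.intro sigma_finite_measure_axioms)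

lemma integrable_pair_fst:
  fixes f :: "'a \<Rightarrow> real"
  assumes "integrable M f"
  shows "integrable (M \<Otimes>\<^sub>M M) (\<lambda>(x, y). f x)"
proof -
  interpret pair_sigma_finite M M by (rule pair_sigma_finite_self)
  have [measurable]: "f \<in> borel_measurable M" using assms by simp
  show ?thesis
    using assms by (intro Fubini_integrable) auto
qed

lemma integrable_pair_snd:
  fixes f :: "'a \<Rightarrow> real"
  assumes "integrable M f"
  shows "integrable (M \<Otimes>\<^sub>M M) (\<lambda>(x, y). f y)"
  using pair_sigma_finite.integrable_product_swap[OF pair_sigma_finite_self integrable_pair_fst[OF assms]]
  by (simp add: case_prod_unfold)

lemma integrable_mult_kernel:
  assumes "integrable (M \<Otimes>\<^sub>M M) h" and \<kappa>: "bounded_kernel M \<kappa>"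
  shows "integrable (M \<Otimes>\<^sub>M M) (\<lambda>(x, y). h (x, y) * \<kappa> x y)"
proof -
  obtain B where B: "\<And>x y. x \<in> space M \<Longrightarrow> y \<in> space M \<Longrightarrow> \<bar>\<kappa> x y\<bar> \<le> B"
    using \<kappa> unfolding bounded_kernel_def by blast
  have [measurable]: "(\<lambda>(x, y). \<kappa> x y) \<in> borel_measurable (M \<Otimes>\<^sub>M M)"
    using \<kappa> by (simp add: bounded_kernel_def)
  show ?thesis
  proof (rule Bochner_Integration.integrable_bound)
    show "integrable (M \<Otimes>\<^sub>M M) (\<lambda>p. B * h p)"
      using assms by simp
    show "(\<lambda>(x, y). h (x, y) * \<kappa> x y) \<in> borel_measurable (M \<Otimes>\<^sub>M M)"
      using assms(1) by (simp add: case_prod_unfold) measurable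
    show "AE p in M \<Otimes>\<^sub>M M. norm (case p of (x, y) \<Rightarrow> h (x, y) * \<kappa> x y) \<le> norm (B * h p)"
    proof (rule AE_I2)
      fix p assume p: "p \<in> space (M \<Otimes>\<^sub>M M)"
      obtain x y where [simp]: "p = (x, y)" by (cases p)
      have "\<bar>\<kappa> x y\<bar> \<le> \<bar>B\<bar>"
        using B[of x y] p by (simp add: space_pair_measure)
      then show "norm (case p of (x, y) \<Rightarrow> h (x, y) * \<kappa> x y) \<le> norm (B * h p)"
        by (simp add: abs_mult mult.commute mult_right_mono)
    qed
  qed
qed

lemma integrable_tensor:
  fixes f g :: "'a \<Rightarrow> real"
  assumes f: "square_integrable M f" and g: "square_integrable M g"
  shows "integrable (M \<Otimes>\<^sub>M M) (\<lambda>(x, y). f x * g y)"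
proof -
  have [measurable]: "f \<in> borel_measurable M" "g \<in> borel_measurable M"
    using f g by (auto simp: square_integrable_def)
  have sf: "square_integrable (M \<Otimes>\<^sub>M M) (\<lambda>p. f (fst p))"
    using integrable_pair_fst[of "\<lambda>x. (f x)\<^sup>2"] f by (simp add: square_integrable_def case_prod_unfold)
  have sg: "square_integrable (M \<Otimes>\<^sub>M M) (\<lambda>p. g (snd p))"
    using integrable_pair_snd[of "\<lambda>x. (g x)\<^sup>2"] g by (simp add: square_integrable_def case_prod_unfold)
  show ?thesis
    using square_integrable_mult_integrable[OF sf sg] by (simp add: case_prod_unfold)
qed

text \<open>The form is an integral over the product measure, hence additive in its arguments and its kernel
without any case distinction on integrability.\<close>

lemma integrable_form_integrand:
  assumes u: "square_integrable M u" and w: "square_integrable M w" and \<kappa>: "bounded_kernel M \<kappa>"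
  shows "integrable (M \<Otimes>\<^sub>M M) (\<lambda>(x, y). (u y - u x) * (w y - w x) * \<kappa> x y)"
proof -
  have "integrable (M \<Otimes>\<^sub>M M) (\<lambda>(x, y). (u y - u x) * (w y - w x))"
    using integrable_pair_fst[OF square_integrable_mult_integrable[OF u w]]
      integrable_pair_snd[OF square_integrable_mult_integrable[OF u w]]
      integrable_tensor[OF u w] integrable_tensor[OF w u]
    by (simp add: case_prod_unfold algebra_simps)
  from integrable_mult_kernel[OF this \<kappa>] show ?thesis by (simp add: case_prod_unfold)
qed

lemma form_eq_pair_integral:
  assumes "square_integrable M u" "square_integrable M w" "bounded_kernel M \<kappa>"
  shows "(\<integral>x. (\<integral>y. (u y - u x) * (w y - w x) * \<kappa> x y \<partial>M) \<partial>M) =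
    (\<integral>(x, y). (u y - u x) * (w y - w x) * \<kappa> x y \<partial>(M \<Otimes>\<^sub>M M))"
  using pair_sigma_finite.integral_fst'[OF pair_sigma_finite_self integrable_form_integrand[OF assms]]
  by simp

lemma integrable_kernel_section:
  assumes \<kappa>: "bounded_kernel M \<kappa>" and x: "x \<in> space M"
  shows "square_integrable M (\<kappa> x)" "integrable M (\<kappa> x)"
proof -
  obtain B where B: "\<And>x y. x \<in> space M \<Longrightarrow> y \<in> space M \<Longrightarrow> \<bar>\<kappa> x y\<bar> \<le> B"
    using \<kappa> unfolding bounded_kernel_def by blast
  have "(\<lambda>(x, y). \<kappa> x y) \<in> borel_measurable (M \<Otimes>\<^sub>M M)"
    using \<kappa> by (simp add: bounded_kernel_def)
  from measurable_Pair2[OF this x] have m: "\<kappa> x \<in> borel_measurable M" by simp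
  show "integrable M (\<kappa> x)"
    using m B x by (intro integrable_const_bound[where B = B]) auto
  have "(\<kappa> x y)\<^sup>2 \<le> B\<^sup>2" if "y \<in> space M" for y
    using B[OF x that] by (metis abs_ge_zero power2_abs power_mono)
  then show "square_integrable M (\<kappa> x)"
    using m by (auto simp: square_integrable_def intro!: integrable_const_bound[where B = "B\<^sup>2"])
qed

text \<open>The diagonal part \<open>D\<close> of the expanded product is controlled by the row sums \<open>c1\<close> of \<open>\<bar>\<kappa>\<bar>\<close>, the mixed
part \<open>X\<close> by the \<open>L\<^sup>2\<close> norms \<open>c2\<close> of the rows; symmetry of \<open>\<kappa>\<close> identifies the other two terms with these
after exchanging \<open>x\<close> and \<open>y\<close>.  The space is nonempty so that \<open>c1\<close> and \<open>c2\<close> are nonnegative.\<close>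

lemma form_bound:
  assumes u: "square_integrable M u" and w: "square_integrable M w"
    and \<kappa>: "bounded_kernel M \<kappa>"
    and sym: "\<And>x y. \<kappa> x y = \<kappa> y x"
    and c1: "\<And>x. x \<in> space M \<Longrightarrow> (\<integral>y. \<bar>\<kappa> x y\<bar> \<partial>M) \<le> c1"
    and c2: "\<And>x. x \<in> space M \<Longrightarrow> sqrt (\<integral>y. (\<kappa> x y)\<^sup>2 \<partial>M) \<le> c2"
    and ne: "space M \<noteq> {}"
  shows "\<bar>\<integral>(x, y). (u y - u x) * (w y - w x) * \<kappa> x y \<partial>(M \<Otimes>\<^sub>M M)\<bar>
    \<le> (2 * c1 + 2 * c2 * sqrt (measure M (space M)))
       * sqrt (\<integral>x. (u x)\<^sup>2 \<partial>M) * sqrt (\<integral>x. (w x)\<^sup>2 \<partial>M)"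
proof -
  interpret P: pair_sigma_finite M M by (rule pair_sigma_finite_self)
  define U W m where "U = sqrt (\<integral>x. (u x)\<^sup>2 \<partial>M)" and "W = sqrt (\<integral>x. (w x)\<^sup>2 \<partial>M)"
    and "m = sqrt (measure M (space M))"
  define k where "k = (\<lambda>x y. \<bar>\<kappa> x y\<bar>)"
  have k: "bounded_kernel M k"
  proof -
    have "(\<lambda>(x, y). \<kappa> x y) \<in> borel_measurable (M \<Otimes>\<^sub>M M)" using \<kappa> by (simp add: bounded_kernel_def)
    then have "(\<lambda>p. \<bar>case p of (x, y) \<Rightarrow> \<kappa> x y\<bar>) \<in> borel_measurable (M \<Otimes>\<^sub>M M)" by measurable
    then show ?thesis using \<kappa> by (simp add: bounded_kernel_def k_def case_prod_unfold)
  qed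
  have k0: "k x y \<ge> 0" and ksym: "k x y = k y x" for x y by (auto simp: k_def sym)
  obtain x0 where "x0 \<in> space M" using ne by blast
  have c1_0: "c1 \<ge> 0"
    using c1[OF \<open>x0 \<in> space M\<close>] by (smt (verit) integral_nonneg_AE AE_I2 abs_ge_zero)
  have c2_0: "c2 \<ge> 0"
    using c2[OF \<open>x0 \<in> space M\<close>] by (smt (verit) integral_nonneg_AE AE_I2 zero_le_power2 real_sqrt_ge_zero)
  define au aw where "au = (\<lambda>x. \<bar>u x\<bar>)" and "aw = (\<lambda>x. \<bar>w x\<bar>)"
  have au: "square_integrable M au" and aw: "square_integrable M aw"
    unfolding au_def aw_def by (intro square_integrable_abs u w)+
  have pos: "au x \<ge> 0" "aw x \<ge> 0" for x by (auto simp: au_def aw_def)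
  have auw: "integrable M (\<lambda>x. au x * aw x)" by (rule square_integrable_mult_integrable[OF au aw])
  define D where "D = (\<lambda>(x, y). au x * aw x * k x y)"
  define X where "X = (\<lambda>(x, y). aw x * au y * k x y)"
  have D: "integrable (M \<Otimes>\<^sub>M M) D"
    using integrable_mult_kernel[OF integrable_pair_fst[OF auw] k] by (simp add: D_def)
  have X: "integrable (M \<Otimes>\<^sub>M M) X"
    using integrable_mult_kernel[OF integrable_tensor[OF aw au] k] by (simp add: X_def)
  have D': "integrable (M \<Otimes>\<^sub>M M) (\<lambda>(x, y). D (y, x))" and X': "integrable (M \<Otimes>\<^sub>M M) (\<lambda>(x, y). X (y, x))"
    by (intro P.integrable_product_swap D X)+
  have D_le: "integral\<^sup>L (M \<Otimes>\<^sub>M M) D \<le> c1 * (U * W)"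
  proof -
    have "integral\<^sup>L (M \<Otimes>\<^sub>M M) D = (\<integral>x. (\<integral>y. D (x, y) \<partial>M) \<partial>M)"
      by (rule P.integral_fst'[OF D, symmetric])
    also have "\<dots> \<le> (\<integral>x. au x * aw x * c1 \<partial>M)"
    proof (rule integral_mono)
      show "integrable M (\<lambda>x. \<integral>y. D (x, y) \<partial>M)" by (rule P.integrable_fst'[OF D])
      show "integrable M (\<lambda>x. au x * aw x * c1)" using auw by simp
      fix x assume x: "x \<in> space M"
      have "(\<integral>y. D (x, y) \<partial>M) = au x * aw x * (\<integral>y. k x y \<partial>M)"
        by (simp add: D_def)
      also have "\<dots> \<le> au x * aw x * c1"
        using c1[OF x] pos by (intro mult_left_mono) (auto simp: k_def)
      finally show "(\<integral>y. D (x, y) \<partial>M) \<le> au x * aw x * c1" .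
    qed
    also have "\<dots> = c1 * (\<integral>x. \<bar>u x * w x\<bar> \<partial>M)"
      by (simp add: au_def aw_def abs_mult)
    also have "\<dots> \<le> c1 * (U * W)"
      using Cauchy_Schwarz_integral[OF u w] c1_0 by (simp add: U_def W_def mult_left_mono)
    finally show ?thesis .
  qed
  have X_le: "integral\<^sup>L (M \<Otimes>\<^sub>M M) X \<le> c2 * m * (U * W)"
  proof -
    have one: "square_integrable M (\<lambda>_. 1)" by (simp add: square_integrable_def)
    have "integral\<^sup>L (M \<Otimes>\<^sub>M M) X = (\<integral>x. (\<integral>y. X (x, y) \<partial>M) \<partial>M)"
      by (rule P.integral_fst'[OF X, symmetric])
    also have "\<dots> \<le> (\<integral>x. aw x * (U * c2) \<partial>M)"
    proof (rule integral_mono)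
      show "integrable M (\<lambda>x. \<integral>y. X (x, y) \<partial>M)" by (rule P.integrable_fst'[OF X])
      show "integrable M (\<lambda>x. aw x * (U * c2))"
        using square_integrable_mult_integrable[OF aw one] by simp
      fix x assume x: "x \<in> space M"
      have "(\<integral>y. X (x, y) \<partial>M) = aw x * (\<integral>y. \<bar>u y * \<kappa> x y\<bar> \<partial>M)"
        by (simp add: X_def au_def k_def abs_mult mult.assoc)
      also have "(\<integral>y. \<bar>u y * \<kappa> x y\<bar> \<partial>M) \<le> U * sqrt (\<integral>y. (\<kappa> x y)\<^sup>2 \<partial>M)"
        unfolding U_def by (rule Cauchy_Schwarz_integral[OF u integrable_kernel_section(1)[OF \<kappa> x]])
      also have "\<dots> \<le> U * c2"
        using c2[OF x] by (intro mult_left_mono) (auto simp: U_def)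
      finally show "(\<integral>y. X (x, y) \<partial>M) \<le> aw x * (U * c2)"
        using pos(2)[of x] by (simp add: mult_left_mono)
    qed
    also have "\<dots> = (U * c2) * (\<integral>x. \<bar>w x * 1\<bar> \<partial>M)"
      by (simp add: aw_def)
    also have "\<dots> \<le> (U * c2) * (W * m)"
      using Cauchy_Schwarz_integral[OF w one] c2_0
      by (intro mult_left_mono) (auto simp: U_def W_def m_def)
    finally show ?thesis by (simp add: mult_ac)
  qed
  have "\<bar>\<integral>(x, y). (u y - u x) * (w y - w x) * \<kappa> x y \<partial>(M \<Otimes>\<^sub>M M)\<bar>
     \<le> (\<integral>p. \<bar>case p of (x, y) \<Rightarrow> (u y - u x) * (w y - w x) * \<kappa> x y\<bar> \<partial>(M \<Otimes>\<^sub>M M))"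
    by (rule integral_abs_bound)
  also have "\<dots> \<le> (\<integral>p. (D p + X p) + ((case p of (x, y) \<Rightarrow> D (y, x)) + (case p of (x, y) \<Rightarrow> X (y, x))) \<partial>(M \<Otimes>\<^sub>M M))"
  proof (rule integral_mono)
    show "integrable (M \<Otimes>\<^sub>M M) (\<lambda>p. \<bar>case p of (x, y) \<Rightarrow> (u y - u x) * (w y - w x) * \<kappa> x y\<bar>)"
      by (intro integrable_abs integrable_form_integrand u w \<kappa>)
    show "integrable (M \<Otimes>\<^sub>M M) (\<lambda>p. (D p + X p) + ((case p of (x, y) \<Rightarrow> D (y, x)) + (case p of (x, y) \<Rightarrow> X (y, x))))"
      by (intro Bochner_Integration.integrable_add D X D' X')
    fix p :: "'a \<times> 'a"
    obtain x y where [simp]: "p = (x, y)" by (cases p)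
    have "\<bar>(u y - u x) * (w y - w x) * \<kappa> x y\<bar> = \<bar>u y - u x\<bar> * \<bar>w y - w x\<bar> * k x y"
      by (simp add: abs_mult k_def)
    also have "\<dots> \<le> (au y + au x) * (aw y + aw x) * k x y"
      using k0 by (intro mult_mono) (auto simp: au_def aw_def)
    finally show "\<bar>case p of (x, y) \<Rightarrow> (u y - u x) * (w y - w x) * \<kappa> x y\<bar>
        \<le> (D p + X p) + ((case p of (x, y) \<Rightarrow> D (y, x)) + (case p of (x, y) \<Rightarrow> X (y, x)))"
      by (simp add: D_def X_def ksym[of y x] algebra_simps)
  qed
  also have "\<dots> = 2 * integral\<^sup>L (M \<Otimes>\<^sub>M M) D + 2 * integral\<^sup>L (M \<Otimes>\<^sub>M M) X"
    using D X D' X' P.integral_product_swap[of D] P.integral_product_swap[of X]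
    by (simp add: borel_measurable_integrable)
  also have "\<dots> \<le> 2 * (c1 * (U * W)) + 2 * (c2 * m * (U * W))"
    using D_le X_le by simp
  finally show ?thesis
    by (simp add: U_def W_def m_def algebra_simps)
qed

end

lemma L2_space_eq: "L2_space S = {f. square_integrable (lebesgue_on S) f}"
  by (simp add: L2_space_def square_integrable_def)

section \<open>Radial kernels and the cutoff\<close>

lemma continuous_on_smooth_profile:
  assumes "smooth_profile \<eta>"
  shows "continuous_on {0..} \<eta>"
proof -
  obtain D :: "nat \<Rightarrow> real \<Rightarrow> real" where D: "\<forall>r\<ge>0. D 0 r = \<eta> r"
      "\<And>k r. r \<ge> 0 \<Longrightarrow> (D k has_real_derivative D (Suc k) r) (at r within {0..})"
    using assms unfolding smooth_profile_def by blast
  have "continuous_on {0..} (D 0)"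
    by (rule DERIV_continuous_on) (use D(2) in auto)
  then show ?thesis
    by (rule continuous_on_eq) (use D(1) in auto)
qed

text \<open>Only the values of a profile on the closed half-line enter, and a profile may be arbitrary on
negative numbers; the truncation \<open>max 0 t\<close> makes measurability a condition on that half-line alone.\<close>

lemma radial_kernel_bounded:
  fixes S :: "'a::euclidean_space set"
  assumes p: "(\<lambda>t. p (max 0 t)) \<in> borel_measurable borel"
    and B: "\<And>t. t \<ge> 0 \<Longrightarrow> \<bar>p t\<bar> \<le> B"
  shows "bounded_kernel (lebesgue_on S) (\<lambda>x y. p (norm (x - y)))"
proof -
  have id: "(\<lambda>x. x) \<in> lebesgue_on S \<rightarrow>\<^sub>M (borel :: 'a measure)"
    by (intro measurable_restrict_space1) (simp add: borel_measurable_if_D measurable_completion)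
  have "(\<lambda>p. fst p) \<in> lebesgue_on S \<Otimes>\<^sub>M lebesgue_on S \<rightarrow>\<^sub>M (borel :: 'a measure)"
    by (rule measurable_compose[OF measurable_fst id])
  moreover have "(\<lambda>p. snd p) \<in> lebesgue_on S \<Otimes>\<^sub>M lebesgue_on S \<rightarrow>\<^sub>M (borel :: 'a measure)"
    by (rule measurable_compose[OF measurable_snd id])
  ultimately have "(\<lambda>q. norm (fst q - snd q)) \<in> borel_measurable (lebesgue_on S \<Otimes>\<^sub>M lebesgue_on S)"
    by (intro measurable_compose[OF _ borel_measurable_norm] borel_measurable_diff)
  from measurable_compose[OF this p]
  show ?thesis
    using B by (auto simp: bounded_kernel_def case_prod_unfold intro!: exI[where x = B])
qed

lemma lebesgue_on_integral_restrict:
  fixes f :: "'a::euclidean_space \<Rightarrow> real"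
  assumes "S \<in> sets lebesgue" "B \<in> sets lebesgue" "\<And>x. x \<in> S - B \<Longrightarrow> f x = 0"
  shows "(\<integral>x. f x \<partial>lebesgue_on (B \<inter> S)) = (\<integral>x. f x \<partial>lebesgue_on S)"
proof -
  have "(\<integral>x. f x \<partial>lebesgue_on (B \<inter> S)) = (\<integral>x. indicator (B \<inter> S) x *\<^sub>R f x \<partial>lebesgue)"
    using assms by (intro integral_restrict_space) auto
  also have "\<dots> = (\<integral>x. indicator S x *\<^sub>R f x \<partial>lebesgue)"
    using assms(3) by (intro Bochner_Integration.integral_cong) (auto simp: indicator_def)
  also have "\<dots> = (\<integral>x. f x \<partial>lebesgue_on S)"
    using assms by (intro integral_restrict_space[symmetric]) auto
  finally show ?thesis .
qed

text \<open>The domain together with its interaction domain is a Minkowski sum with a closed ball; this gives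
openness and boundedness, hence finite measure.\<close>

lemma neighbourhood_eq_sums:
  "\<Omega> \<union> interaction_domain \<delta> \<Omega> = (\<Union>x\<in>\<Omega>. \<Union>z\<in>cball 0 \<delta>. {x + z})" if "\<delta> \<ge> 0"
proof (intro equalityI subsetI)
  fix y assume "y \<in> \<Omega> \<union> interaction_domain \<delta> \<Omega>"
  then have "\<exists>x\<in>\<Omega>. norm (x - y) \<le> \<delta>"
    using that by (cases "y \<in> \<Omega>") (auto simp: interaction_domain_def intro!: bexI[of _ y])
  then obtain x where "x \<in> \<Omega>" "norm (x - y) \<le> \<delta>"
    by blast
  then show "y \<in> (\<Union>x\<in>\<Omega>. \<Union>z\<in>cball 0 \<delta>. {x + z})"
    by (intro UN_I[of x] UN_I[of "y - x"]) (auto simp: norm_minus_commute)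
next
  fix y assume "y \<in> (\<Union>x\<in>\<Omega>. \<Union>z\<in>cball 0 \<delta>. {x + z})"
  then show "y \<in> \<Omega> \<union> interaction_domain \<delta> \<Omega>"
    by (force simp: interaction_domain_def)
qed

text \<open>The absolute values of the coefficients add up to \<open>1456 / 256 < 6\<close>.\<close>

lemma cutoff_poly_bound:
  assumes "\<bar>r\<bar> \<le> 1" shows "\<bar>cutoff_poly r\<bar> \<le> 6"
proof -
  have b: "\<bar>r ^ k\<bar> \<le> 1" for k using assms by (simp add: power_abs power_le_one)
  show ?thesis
    using b[of 1] b[of 3] b[of 5] b[of 7] b[of 9] unfolding cutoff_poly_def by (simp add: abs_le_iff)
qed

lemma cutoff_bound:
  assumes "\<epsilon> > 0" shows "\<bar>cutoff \<delta> \<epsilon> s\<bar> \<le> 6"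
  using assms by (auto simp: cutoff_def divide_simps intro!: cutoff_poly_bound)

lemma cutoff_measurable: "cutoff \<delta> \<epsilon> \<in> borel_measurable borel"
  unfolding cutoff_def[abs_def] cutoff_poly_def by measurable

section \<open>Error constants\<close>

text \<open>Both error integrals may be taken over all of \<open>S\<close>, as the kernels agree at distance \<open>R\<close> and beyond.\<close>

lemma error_integral_eq:
  fixes h :: "real \<Rightarrow> real"
  assumes S: "S \<in> lmeasurable" and far: "\<And>x y. R \<le> dist x y \<Longrightarrow> \<kappa> x y = \<gamma> x y" and "h 0 = 0"
  shows "(\<integral>y. h (\<kappa> x y - \<gamma> x y) \<partial>lebesgue_on (ball x R \<inter> S)) = (\<integral>y. h (\<kappa> x y - \<gamma> x y) \<partial>lebesgue_on S)"
proof (rule lebesgue_on_integral_restrict)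
  show "S \<in> sets lebesgue" by (rule fmeasurableD[OF S])
  show "ball x R \<in> sets lebesgue" by simp
  show "h (\<kappa> x y - \<gamma> x y) = 0" if "y \<in> S - ball x R" for y
    using that far[of x y] \<open>h 0 = 0\<close> by simp
qed

text \<open>A supremum bounds its members only if it is over a set bounded above, which holds here because the
kernel difference is bounded and \<open>S\<close> has finite measure.\<close>

lemma error_constants_bound_sections:
  assumes S: "S \<in> lmeasurable"
    and d: "bounded_kernel (lebesgue_on S) (\<lambda>x y. \<kappa> x y - \<gamma> x y)"
    and far: "\<And>x y. R \<le> dist x y \<Longrightarrow> \<kappa> x y = \<gamma> x y"
    and x: "x \<in> S"
  shows "(\<integral>y. \<bar>\<kappa> x y - \<gamma> x y\<bar> \<partial>lebesgue_on S) \<le> error_c1 S R \<gamma> \<kappa>"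
    and "sqrt (\<integral>y. (\<kappa> x y - \<gamma> x y)\<^sup>2 \<partial>lebesgue_on S) \<le> error_c2 S R \<gamma> \<kappa>"
proof -
  interpret finite_measure "lebesgue_on S" by (rule finite_measure_lebesgue_on[OF S])
  obtain B where B: "\<And>x y. x \<in> S \<Longrightarrow> y \<in> S \<Longrightarrow> \<bar>\<kappa> x y - \<gamma> x y\<bar> \<le> B"
    using d unfolding bounded_kernel_def by auto
  have e1: "(\<integral>y. \<bar>\<kappa> x y - \<gamma> x y\<bar> \<partial>lebesgue_on (ball x R \<inter> S)) = (\<integral>y. \<bar>\<kappa> x y - \<gamma> x y\<bar> \<partial>lebesgue_on S)" for x
    by (rule error_integral_eq[where h = abs, OF S far abs_zero])
  have e2: "(\<integral>y. (\<kappa> x y - \<gamma> x y)\<^sup>2 \<partial>lebesgue_on (ball x R \<inter> S)) = (\<integral>y. (\<kappa> x y - \<gamma> x y)\<^sup>2 \<partial>lebesgue_on S)" for x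
    by (rule error_integral_eq[where h = "\<lambda>t. t\<^sup>2", OF S far zero_power2])
  have "(\<integral>y. \<bar>\<kappa> x y - \<gamma> x y\<bar> \<partial>lebesgue_on S) \<le> (\<integral>y. B \<partial>lebesgue_on S)" if "x \<in> S" for x
    using integrable_kernel_section(2)[OF d, of x] B that by (intro integral_mono integrable_abs) auto
  then have bdd1: "bdd_above ((\<lambda>x. \<integral>y. \<bar>\<kappa> x y - \<gamma> x y\<bar> \<partial>lebesgue_on S) ` S)"
    by (rule bdd_aboveI2)
  have "(\<kappa> x y - \<gamma> x y)\<^sup>2 \<le> B\<^sup>2" if "x \<in> S" "y \<in> S" for x y
    using power_mono[OF B[OF that], of 2] by simp
  then have "(\<integral>y. (\<kappa> x y - \<gamma> x y)\<^sup>2 \<partial>lebesgue_on S) \<le> (\<integral>y. B\<^sup>2 \<partial>lebesgue_on S)" if "x \<in> S" for x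
    using integrable_kernel_section(1)[OF d, of x] that
    by (intro integral_mono) (auto simp: square_integrable_def)
  then have bdd2: "bdd_above ((\<lambda>x. \<integral>y. (\<kappa> x y - \<gamma> x y)\<^sup>2 \<partial>lebesgue_on S) ` S)"
    by (rule bdd_aboveI2)
  show "(\<integral>y. \<bar>\<kappa> x y - \<gamma> x y\<bar> \<partial>lebesgue_on S) \<le> error_c1 S R \<gamma> \<kappa>"
    unfolding error_c1_def e1 by (rule cSUP_upper[OF x bdd1])
  show "sqrt (\<integral>y. (\<kappa> x y - \<gamma> x y)\<^sup>2 \<partial>lebesgue_on S) \<le> error_c2 S R \<gamma> \<kappa>"
    unfolding error_c2_def e2 by (intro real_sqrt_le_mono cSUP_upper[OF x bdd2])
qed

lemma error_k_nonneg:
  assumes S: "S \<in> lmeasurable" "S \<noteq> {}"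
    and d: "bounded_kernel (lebesgue_on S) (\<lambda>x y. \<kappa> x y - \<gamma> x y)"
    and far: "\<And>x y. R \<le> dist x y \<Longrightarrow> \<kappa> x y = \<gamma> x y"
  shows "error_k S R \<gamma> \<kappa> \<ge> 0"
proof -
  obtain x where x: "x \<in> S" using S by blast
  note le = error_constants_bound_sections[OF S(1) d far x]
  have "0 \<le> (\<integral>y. \<bar>\<kappa> x y - \<gamma> x y\<bar> \<partial>lebesgue_on S)" by simp
  also note le(1)
  finally have 1: "error_c1 S R \<gamma> \<kappa> \<ge> 0" .
  have "0 \<le> sqrt (\<integral>y. (\<kappa> x y - \<gamma> x y)\<^sup>2 \<partial>lebesgue_on S)" by simp
  also note le(2)
  finally have "error_c2 S R \<gamma> \<kappa> \<ge> 0" .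
  with 1 show ?thesis by (simp add: error_k_def)
qed

lemma bounded_kernel_diff:
  assumes "bounded_kernel M \<kappa>" "bounded_kernel M \<gamma>"
  shows "bounded_kernel M (\<lambda>x y. \<kappa> x y - \<gamma> x y)"
proof -
  obtain A B where "\<And>x y. x \<in> space M \<Longrightarrow> y \<in> space M \<Longrightarrow> \<bar>\<kappa> x y\<bar> \<le> A"
      "\<And>x y. x \<in> space M \<Longrightarrow> y \<in> space M \<Longrightarrow> \<bar>\<gamma> x y\<bar> \<le> B"
    using assms unfolding bounded_kernel_def by metis
  then have "\<bar>\<kappa> x y - \<gamma> x y\<bar> \<le> A + B" if "x \<in> space M" "y \<in> space M" for x y
    using that by (smt (verit))
  moreover have "(\<lambda>p. (case p of (x, y) \<Rightarrow> \<kappa> x y) - (case p of (x, y) \<Rightarrow> \<gamma> x y)) \<in> borel_measurable (M \<Otimes>\<^sub>M M)"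
    using assms by (intro borel_measurable_diff) (auto simp: bounded_kernel_def)
  ultimately show ?thesis
    unfolding bounded_kernel_def by (auto simp: case_prod_unfold)
qed

section \<open>Perturbation of the kernel\<close>

text \<open>For a bounded kernel on a set of finite measure every square-integrable function has finite energy.
In particular the difference of two weak solutions lies in the energy space.\<close>

lemma energy_space_bounded_kernel:
  assumes S: "S \<in> lmeasurable" and \<gamma>: "bounded_kernel (lebesgue_on S) \<gamma>"
    and w: "square_integrable (lebesgue_on S) w"
  shows "w \<in> energy_space S \<gamma>"
proof -
  interpret finite_measure "lebesgue_on S" by (rule finite_measure_lebesgue_on[OF S])
  let ?P = "lebesgue_on S \<Otimes>\<^sub>M lebesgue_on S"
  let ?g = "\<lambda>(x, y). (w y - w x) * (w y - w x) * \<gamma> x y"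
  have g: "integrable ?P ?g" by (rule integrable_form_integrand[OF w w \<gamma>])
  have "(\<integral>\<^sup>+x. (\<integral>\<^sup>+y. ennreal ((w y - w x)\<^sup>2 * \<gamma> x y) \<partial>lebesgue_on S) \<partial>lebesgue_on S)
      = (\<integral>\<^sup>+x. (\<integral>\<^sup>+y. ennreal (?g (x, y)) \<partial>lebesgue_on S) \<partial>lebesgue_on S)"
    by (simp add: power2_eq_square)
  also have "\<dots> = (\<integral>\<^sup>+p. ennreal (?g p) \<partial>?P)"
    using g by (intro nn_integral_fst) (simp add: borel_measurable_integrable)
  also have "\<dots> \<le> (\<integral>\<^sup>+p. ennreal (norm (?g p)) \<partial>?P)"
    by (intro nn_integral_mono ennreal_leI) simp
  also have "\<dots> < \<infinity>"
    using g by (simp add: integrable_iff_bounded)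
  finally show ?thesis
    using w by (simp add: energy_space_def L2_space_eq)
qed

text \<open>The energy of the error \<open>w\<close> equals the form of \<open>\<kappa> - \<gamma>\<close> at \<open>(v, w)\<close>, so \<open>form_bound\<close> and coercivity
bound \<open>\<parallel>w\<parallel>\<^sup>2\<close> by a multiple of \<open>\<parallel>w\<parallel>\<close>.  If \<open>\<parallel>w\<parallel> = 0\<close>, nothing can be cancelled and the claim is
nonnegativity of the right-hand side.\<close>

lemma weak_solution_kernel_perturbation:
  fixes S :: "'a::euclidean_space set"
  assumes S: "S \<in> lmeasurable" "S \<noteq> {}"
    and \<gamma>: "bounded_kernel (lebesgue_on S) \<gamma>" and \<kappa>: "bounded_kernel (lebesgue_on S) \<kappa>"
    and sym: "\<And>x y. \<gamma> x y = \<gamma> y x" "\<And>x y. \<kappa> x y = \<kappa> y x"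
    and nonneg: "\<And>x y. \<gamma> x y \<ge> 0"
    and far: "\<And>x y. R \<le> dist x y \<Longrightarrow> \<kappa> x y = \<gamma> x y"
    and "C > 0"
    and coercive: "\<And>\<phi>. \<phi> \<in> constrained_space S \<Gamma> \<gamma> \<Longrightarrow>
            (L2_norm_on S \<phi>)\<^sup>2 \<le> C * (energy_norm S \<gamma> \<phi>)\<^sup>2"
    and u: "weak_solution S \<Gamma> \<gamma> \<gamma> F g u" and v: "weak_solution S \<Gamma> \<gamma> \<kappa> F g v"
  shows "L2_norm_on S (\<lambda>x. u x - v x) \<le> C * error_k S R \<gamma> \<kappa> * L2_norm_on S v"
proof -
  interpret finite_measure "lebesgue_on S" by (rule finite_measure_lebesgue_on[OF S(1)])
  let ?P = "lebesgue_on S \<Otimes>\<^sub>M lebesgue_on S"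
  define w where "w = (\<lambda>x. u x - v x)"
  define d where "d = (\<lambda>x y. \<kappa> x y - \<gamma> x y)"
  have su: "square_integrable (lebesgue_on S) u" and sv: "square_integrable (lebesgue_on S) v"
    using u v by (auto simp: weak_solution_def energy_space_def L2_space_eq)
  have sw: "square_integrable (lebesgue_on S) w"
    unfolding w_def by (rule square_integrable_diff[OF su sv])
  have d: "bounded_kernel (lebesgue_on S) d"
    unfolding d_def by (rule bounded_kernel_diff[OF \<kappa> \<gamma>])
  have "AE x in lebesgue_on \<Gamma>. u x = g x" "AE x in lebesgue_on \<Gamma>. v x = g x"
    using u v by (auto simp: weak_solution_def)
  then have "AE x in lebesgue_on \<Gamma>. w x = 0"
    by eventually_elim (simp add: w_def)
  then have w: "w \<in> constrained_space S \<Gamma> \<gamma>"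
    using energy_space_bounded_kernel[OF S(1) \<gamma> sw] by (simp add: constrained_space_def)
  define A where "A = (\<lambda>(\<kappa> :: 'a \<Rightarrow> 'a \<Rightarrow> real) (u :: 'a \<Rightarrow> real) (\<phi> :: 'a \<Rightarrow> real). \<integral>(x, y). (u y - u x) * (\<phi> y - \<phi> x) * \<kappa> x y \<partial>?P)"
  have form: "nonlocal_form S \<kappa> u \<phi> = A \<kappa> u \<phi>"
    if "square_integrable (lebesgue_on S) u" "square_integrable (lebesgue_on S) \<phi>"
      "bounded_kernel (lebesgue_on S) \<kappa>" for \<kappa> u \<phi>
    using form_eq_pair_integral[OF that] by (simp add: nonlocal_form_def A_def)
  \<comment> \<open>both problems tested with the error itself\<close>
  have "A \<gamma> u w = F w" "A \<kappa> v w = F w"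
    using u v w su sv sw \<gamma> \<kappa> by (auto simp: weak_solution_def simp flip: form)
  moreover have "A \<gamma> w w = A \<gamma> u w - A \<gamma> v w"
    using integrable_form_integrand[OF su sw \<gamma>] integrable_form_integrand[OF sv sw \<gamma>]
    unfolding A_def by (subst Bochner_Integration.integral_diff[symmetric])
      (auto simp: w_def case_prod_unfold algebra_simps intro!: Bochner_Integration.integral_cong)
  moreover have "A d v w = A \<kappa> v w - A \<gamma> v w"
    using integrable_form_integrand[OF sv sw \<kappa>] integrable_form_integrand[OF sv sw \<gamma>]
    unfolding A_def by (subst Bochner_Integration.integral_diff[symmetric])
      (auto simp: d_def case_prod_unfold algebra_simps intro!: Bochner_Integration.integral_cong)
  ultimately have eq: "A \<gamma> w w = A d v w" by simp
  have bound: "\<bar>A d v w\<bar> \<le> error_k S R \<gamma> \<kappa> * L2_norm_on S v * L2_norm_on S w"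
  proof -
    have m: "measure (lebesgue_on S) (space (lebesgue_on S)) = measure lebesgue S"
      using S(1) by (simp add: measure_restrict_space fmeasurableD)
    have "\<bar>A d v w\<bar> \<le> (2 * error_c1 S R \<gamma> \<kappa>
          + 2 * error_c2 S R \<gamma> \<kappa> * sqrt (measure (lebesgue_on S) (space (lebesgue_on S))))
          * sqrt (\<integral>x. (v x)\<^sup>2 \<partial>lebesgue_on S) * sqrt (\<integral>x. (w x)\<^sup>2 \<partial>lebesgue_on S)"
      unfolding A_def
    proof (rule form_bound[OF sv sw d])
      show "d x y = d y x" for x y by (simp only: d_def sym[of x y])
      show "(\<integral>y. \<bar>d x y\<bar> \<partial>lebesgue_on S) \<le> error_c1 S R \<gamma> \<kappa>"
        and "sqrt (\<integral>y. (d x y)\<^sup>2 \<partial>lebesgue_on S) \<le> error_c2 S R \<gamma> \<kappa>"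
        if "x \<in> space (lebesgue_on S)" for x
        using error_constants_bound_sections[OF S(1) d[unfolded d_def] far, where x = x] that
        by (simp_all add: d_def)
      show "space (lebesgue_on S) \<noteq> {}" using S(2) by simp
    qed
    then show ?thesis
      by (simp only: m error_k_def L2_norm_on_def)
  qed
  have "A \<gamma> w w \<ge> 0"
    unfolding A_def using nonneg by (intro Bochner_Integration.integral_nonneg) (auto simp: mult_nonneg_nonneg)
  then have "(energy_norm S \<gamma> w)\<^sup>2 = A \<gamma> w w"
    by (simp add: energy_norm_def form[OF sw sw \<gamma>])
  then have "(L2_norm_on S w)\<^sup>2 \<le> C * A \<gamma> w w"
    using coercive[OF w] by simp
  also have "\<dots> \<le> C * (error_k S R \<gamma> \<kappa> * L2_norm_on S v * L2_norm_on S w)"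
    using bound \<open>C > 0\<close> unfolding eq by (intro mult_left_mono) auto
  finally have main: "L2_norm_on S w * L2_norm_on S w \<le> (C * error_k S R \<gamma> \<kappa> * L2_norm_on S v) * L2_norm_on S w"
    by (simp add: power2_eq_square mult_ac)
  have w0: "L2_norm_on S w \<ge> 0" by (simp add: L2_norm_on_def)
  show ?thesis
  proof (cases "L2_norm_on S w = 0")
    case True
    have "error_k S R \<gamma> \<kappa> \<ge> 0"
      by (rule error_k_nonneg[OF S d[unfolded d_def] far])
    with True show ?thesis using \<open>C > 0\<close> by (simp add: w_def[symmetric] L2_norm_on_def)
  next
    case False
    with main w0 show ?thesis by (simp add: w_def[symmetric])
  qed
qed

section \<open>Comparison of the exact and the approximate kernel\<close>

lemma smooth_profile_bounded:
  assumes "smooth_profile \<eta>"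
  obtains H where "H \<ge> 0" "\<And>t. 0 \<le> t \<Longrightarrow> t \<le> T \<Longrightarrow> \<bar>\<eta> t\<bar> \<le> H"
proof -
  have "continuous_on {0..T} \<eta>"
    by (rule continuous_on_subset[OF continuous_on_smooth_profile[OF assms]]) auto
  then have "bounded (\<eta> ` {0..T})"
    by (intro compact_imp_bounded compact_continuous_image) auto
  then obtain H where "\<forall>t\<in>{0..T}. \<bar>\<eta> t\<bar> \<le> H"
    by (auto simp: bounded_iff)
  then show ?thesis by (intro that[of "max 0 H"]) (auto intro: max.coboundedI2)
qed

lemma smooth_profile_measurable:
  assumes "smooth_profile \<eta>"
  shows "(\<lambda>t. \<eta> (max 0 t)) \<in> borel_measurable borel"
  by (intro borel_measurable_continuous_onI
      continuous_on_compose2[OF continuous_on_smooth_profile[OF assms]] continuous_intros) auto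

lemma exact_kernel_radial:
  "exact_kernel C \<eta> \<delta> x y = C * \<eta> (norm (x - y)) * indicator {..<\<delta>} (norm (x - y))"
  by (simp add: exact_kernel_def indicator_def dist_norm)

lemma bounded_exact_kernel:
  assumes "smooth_profile \<eta>"
  shows "bounded_kernel (lebesgue_on S) (exact_kernel C \<eta> \<delta>)"
proof -
  obtain H where H: "H \<ge> 0" "\<And>t. 0 \<le> t \<Longrightarrow> t \<le> \<delta> \<Longrightarrow> \<bar>\<eta> t\<bar> \<le> H"
    using smooth_profile_bounded[OF assms] by blast
  have [measurable]: "(\<lambda>t. \<eta> (max 0 t)) \<in> borel_measurable borel"
    by (rule smooth_profile_measurable[OF assms])
  have "bounded_kernel (lebesgue_on S)
      (\<lambda>x y. (\<lambda>t. C * \<eta> t * indicator {..<\<delta>} t) (norm (x - y)))"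
  proof (rule radial_kernel_bounded)
    show "\<bar>C * \<eta> t * indicator {..<\<delta>} t\<bar> \<le> \<bar>C\<bar> * H" if "t \<ge> 0" for t
      using that H by (auto simp: indicator_def abs_mult intro!: mult_left_mono)
  qed measurable
  then show ?thesis by (simp add: exact_kernel_radial[abs_def])
qed

lemma bounded_approx_kernel:
  assumes "smooth_profile \<eta>" "\<epsilon> > 0"
  shows "bounded_kernel (lebesgue_on S) (approx_kernel C \<eta> \<delta> \<epsilon>)"
proof -
  obtain H where H: "H \<ge> 0" "\<And>t. 0 \<le> t \<Longrightarrow> t \<le> \<delta> + \<epsilon> \<Longrightarrow> \<bar>\<eta> t\<bar> \<le> H"
    using smooth_profile_bounded[OF assms(1)] by blast
  have [measurable]: "(\<lambda>t. \<eta> (max 0 t)) \<in> borel_measurable borel"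
    by (rule smooth_profile_measurable[OF assms(1)])
  have [measurable]: "cutoff \<delta> \<epsilon> \<in> borel_measurable borel"
    by (rule cutoff_measurable)
  have "bounded_kernel (lebesgue_on S) (\<lambda>x y. (\<lambda>t. C * \<eta> t * cutoff \<delta> \<epsilon> t) (norm (x - y)))"
  proof (rule radial_kernel_bounded)
    show "\<bar>C * \<eta> t * cutoff \<delta> \<epsilon> t\<bar> \<le> \<bar>C\<bar> * H * 6" if "t \<ge> 0" for t
    proof (cases "t \<le> \<delta> + \<epsilon>")
      case True
      with that show ?thesis
        unfolding abs_mult using H cutoff_bound[OF assms(2)] by (intro mult_mono) auto
    next
      case False
      with \<open>\<epsilon> > 0\<close> H(1) show ?thesis by (simp add: cutoff_def)
    qed
  qed measurable
  then show ?thesis by (simp add: approx_kernel_def[abs_def])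
qed

text \<open>At distance exactly \<open>\<delta> + \<epsilon>\<close> the cutoff is given by the polynomial, which has a root at \<open>-1\<close>.\<close>

lemma approx_kernel_eq_exact_kernel_far:
  assumes "\<epsilon> > 0" "\<delta> + \<epsilon> \<le> dist x y"
  shows "approx_kernel C' \<eta> \<delta> \<epsilon> x y = exact_kernel C \<eta> \<delta> x y"
proof -
  have "cutoff_poly (- 1) = 0" by (simp add: cutoff_poly_def)
  then have "cutoff \<delta> \<epsilon> (norm (x - y)) = 0"
    using assms by (auto simp: cutoff_def dist_norm)
  then show ?thesis
    using assms by (simp add: approx_kernel_def exact_kernel_def indicator_def)
qed

text \<open>The difference splits as \<open>(C' - C) \<eta> \<mu> + C \<eta> (\<mu> - \<chi>)\<close> with the smooth cutoff \<open>\<mu>\<close> and the sharp cutoff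
\<open>\<chi>\<close>.  The first summand is small with \<open>C' - C\<close>; the second is supported where the cutoffs differ, an
annulus, and there \<open>\<bar>\<mu> - \<chi>\<bar> \<le> 6 + 1\<close>.\<close>

lemma kernel_difference_bound:
  assumes \<epsilon>: "0 < \<epsilon>" "\<epsilon> < \<delta>" and "C \<ge> 0" "H \<ge> 0"
    and H: "\<And>t. 0 \<le> t \<Longrightarrow> t \<le> 2 * \<delta> \<Longrightarrow> \<bar>\<eta> t\<bar> \<le> H"
  shows "\<bar>approx_kernel C' \<eta> \<delta> \<epsilon> x y - exact_kernel C \<eta> \<delta> x y\<bar>
    \<le> 6 * H * \<bar>C' - C\<bar> + 7 * C * H * indicator (cball x (\<delta> + \<epsilon>) - ball x (\<delta> - \<epsilon>)) y"
proof -
  define t where "t = norm (x - y)"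
  define I where "I = (indicator {..<\<delta>} t :: real)"
  have eq: "approx_kernel C' \<eta> \<delta> \<epsilon> x y - exact_kernel C \<eta> \<delta> x y
      = (C' - C) * \<eta> t * cutoff \<delta> \<epsilon> t + C * \<eta> t * (cutoff \<delta> \<epsilon> t - I)"
    by (simp add: approx_kernel_def exact_kernel_radial t_def I_def algebra_simps)
  show ?thesis
  proof (cases "t \<le> \<delta> + \<epsilon>")
    case True
    then have Ht: "\<bar>\<eta> t\<bar> \<le> H" using \<epsilon> by (intro H) (auto simp: t_def)
    have c: "\<bar>cutoff \<delta> \<epsilon> t\<bar> \<le> 6" by (rule cutoff_bound[OF \<epsilon>(1)])
    have "\<bar>(C' - C) * \<eta> t * cutoff \<delta> \<epsilon> t\<bar> \<le> \<bar>C' - C\<bar> * H * 6"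
      unfolding abs_mult using Ht c by (intro mult_mono) auto
    moreover have "\<bar>C * \<eta> t * (cutoff \<delta> \<epsilon> t - I)\<bar>
        \<le> C * H * (7 * indicator (cball x (\<delta> + \<epsilon>) - ball x (\<delta> - \<epsilon>)) y)"
    proof -
      have "\<bar>cutoff \<delta> \<epsilon> t - I\<bar> \<le> 7 * indicator (cball x (\<delta> + \<epsilon>) - ball x (\<delta> - \<epsilon>)) y"
      proof (cases "t < \<delta> - \<epsilon>")
        case True
        then show ?thesis using \<epsilon> by (simp add: cutoff_def I_def)
      next
        case False
        then have "indicator (cball x (\<delta> + \<epsilon>) - ball x (\<delta> - \<epsilon>)) y = (1::real)"
          using \<open>t \<le> \<delta> + \<epsilon>\<close> by (simp add: t_def dist_norm)
        moreover have "\<bar>I\<bar> \<le> 1" by (simp add: I_def indicator_def)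
        ultimately show ?thesis using c by simp
      qed
      then show ?thesis
        unfolding abs_mult using Ht \<open>C \<ge> 0\<close> \<open>H \<ge> 0\<close> by (intro mult_mono) auto
    qed
    ultimately show ?thesis unfolding eq by (simp add: mult_ac)
  next
    case False
    then have "approx_kernel C' \<eta> \<delta> \<epsilon> x y = exact_kernel C \<eta> \<delta> x y"
      using \<epsilon> by (intro approx_kernel_eq_exact_kernel_far) (auto simp: t_def dist_norm)
    then show ?thesis using assms(3,4) by simp
  qed
qed

lemma measure_annulus:
  fixes x :: "'a::euclidean_space"
  assumes "0 \<le> r" "r \<le> R"
  shows "measure lebesgue (cball x R - ball x r) = unit_ball_vol DIM('a) * (R ^ DIM('a) - r ^ DIM('a))"
proof -
  have "measure lebesgue (cball x R - ball x r) = measure lebesgue (cball x R) - measure lebesgue (ball x r)"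
    using assms by (intro measurable_measure_Diff) auto
  then show ?thesis using assms by (simp add: content_cball content_ball algebra_simps)
qed

text \<open>Here \<open>q\<close> bounds the \<open>L\<^sup>1\<close> norm of every row of the kernel difference.  Since the difference is at most
\<open>a + b\<close> pointwise, \<open>(a + b) q\<close> bounds the squared \<open>L\<^sup>2\<close> norm of the row.\<close>

lemma error_k_le:
  fixes S :: "'a::euclidean_space set"
  assumes S: "S \<in> lmeasurable" "S \<noteq> {}"
    and d: "bounded_kernel (lebesgue_on S) (\<lambda>x y. \<kappa> x y - \<gamma> x y)"
    and far: "\<And>x y. R \<le> dist x y \<Longrightarrow> \<kappa> x y = \<gamma> x y"
    and r: "0 \<le> r" "r \<le> R" and ab: "a \<ge> 0" "b \<ge> 0"
    and bound: "\<And>x y. \<bar>\<kappa> x y - \<gamma> x y\<bar> \<le> a + b * indicator (cball x R - ball x r) y"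
  defines "q \<equiv> a * measure lebesgue S + b * (unit_ball_vol DIM('a) * (R ^ DIM('a) - r ^ DIM('a)))"
  shows "error_k S R \<gamma> \<kappa> \<le> 2 * q + 2 * sqrt ((a + b) * q) * sqrt (measure lebesgue S)"
proof -
  interpret finite_measure "lebesgue_on S" by (rule finite_measure_lebesgue_on[OF S(1)])
  have e1: "(\<integral>y. \<bar>\<kappa> x y - \<gamma> x y\<bar> \<partial>lebesgue_on (ball x R \<inter> S)) = (\<integral>y. \<bar>\<kappa> x y - \<gamma> x y\<bar> \<partial>lebesgue_on S)" for x
    by (rule error_integral_eq[where h = abs, OF S(1) far abs_zero])
  have e2: "(\<integral>y. (\<kappa> x y - \<gamma> x y)\<^sup>2 \<partial>lebesgue_on (ball x R \<inter> S)) = (\<integral>y. (\<kappa> x y - \<gamma> x y)\<^sup>2 \<partial>lebesgue_on S)" for x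
    by (rule error_integral_eq[where h = "\<lambda>t. t\<^sup>2", OF S(1) far zero_power2])
  have le1: "(\<integral>y. \<bar>\<kappa> x y - \<gamma> x y\<bar> \<partial>lebesgue_on (ball x R \<inter> S)) \<le> q" if "x \<in> S" for x
  proof -
    let ?A = "cball x R - ball x r"
    have Sl: "S \<in> sets lebesgue" by (rule fmeasurableD[OF S(1)])
    have Al: "?A \<in> sets lebesgue" by simp
    have A: "?A \<inter> S \<in> sets (lebesgue_on S)"
      using sets.Int[OF Al Sl] Sl by (subst sets_restrict_space_iff) simp_all
    have int: "integrable (lebesgue_on S) (indicator (?A \<inter> S) :: 'a \<Rightarrow> real)"
      using A by (simp add: less_top[symmetric])
    have "(\<integral>y. \<bar>\<kappa> x y - \<gamma> x y\<bar> \<partial>lebesgue_on (ball x R \<inter> S)) = (\<integral>y. \<bar>\<kappa> x y - \<gamma> x y\<bar> \<partial>lebesgue_on S)"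
      by (rule e1)
    also have "\<dots> \<le> (\<integral>y. a + b * indicator (?A \<inter> S) y \<partial>lebesgue_on S)"
    proof (rule integral_mono)
      show "integrable (lebesgue_on S) (\<lambda>y. \<bar>\<kappa> x y - \<gamma> x y\<bar>)"
        using integrable_kernel_section(2)[OF d, of x] that by simp
      show "integrable (lebesgue_on S) (\<lambda>y. a + b * indicator (?A \<inter> S) y)"
        using int by simp
      show "\<bar>\<kappa> x y - \<gamma> x y\<bar> \<le> a + b * indicator (?A \<inter> S) y" if "y \<in> space (lebesgue_on S)" for y
        using bound[of x y] that by (simp add: indicator_def)
    qed
    also have "\<dots> = a * measure lebesgue S + b * measure lebesgue (?A \<inter> S)"
      using int Sl by (simp add: measure_restrict_space)
    also have "measure lebesgue (?A \<inter> S) \<le> measure lebesgue ?A"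
      by (rule measure_mono_fmeasurable[OF _ sets.Int[OF Al Sl]]) auto
    finally show ?thesis
      using ab unfolding q_def measure_annulus[OF r] by (simp add: mult_left_mono)
  qed
  have le2: "(\<integral>y. (\<kappa> x y - \<gamma> x y)\<^sup>2 \<partial>lebesgue_on (ball x R \<inter> S)) \<le> (a + b) * q" if x: "x \<in> S" for x
  proof -
    have "(\<kappa> x y - \<gamma> x y)\<^sup>2 \<le> (a + b) * \<bar>\<kappa> x y - \<gamma> x y\<bar>" for y
    proof -
      have "\<bar>\<kappa> x y - \<gamma> x y\<bar> \<le> a + b"
        using bound[of x y] ab by (cases "y \<in> cball x R - ball x r") simp_all
      then have "\<bar>\<kappa> x y - \<gamma> x y\<bar> * \<bar>\<kappa> x y - \<gamma> x y\<bar> \<le> (a + b) * \<bar>\<kappa> x y - \<gamma> x y\<bar>"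
        by (rule mult_right_mono) simp
      then show ?thesis by (simp add: power2_eq_square)
    qed
    then have "(\<integral>y. (\<kappa> x y - \<gamma> x y)\<^sup>2 \<partial>lebesgue_on S) \<le> (\<integral>y. (a + b) * \<bar>\<kappa> x y - \<gamma> x y\<bar> \<partial>lebesgue_on S)"
      using integrable_kernel_section[OF d, of x] x
      by (intro integral_mono) (auto simp: square_integrable_def)
    then have "(\<integral>y. (\<kappa> x y - \<gamma> x y)\<^sup>2 \<partial>lebesgue_on (ball x R \<inter> S))
        \<le> (a + b) * (\<integral>y. \<bar>\<kappa> x y - \<gamma> x y\<bar> \<partial>lebesgue_on (ball x R \<inter> S))"
      by (simp add: e1 e2)
    also have "\<dots> \<le> (a + b) * q"
      using le1[OF x] ab by (intro mult_left_mono) auto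
    finally show ?thesis .
  qed
  have "error_c1 S R \<gamma> \<kappa> \<le> q"
    unfolding error_c1_def by (intro cSUP_least S le1)
  moreover have "error_c2 S R \<gamma> \<kappa> \<le> sqrt ((a + b) * q)"
    unfolding error_c2_def by (intro real_sqrt_le_mono cSUP_least S le2)
  ultimately show ?thesis
    unfolding error_k_def by (intro add_mono mult_left_mono mult_right_mono) auto
qed

lemma error_k_tendsto_0:
  fixes S :: "'a::euclidean_space set"
  assumes S: "S \<in> lmeasurable" "S \<noteq> {}" and \<eta>: "smooth_profile \<eta>"
    and "\<delta> > 0" "C \<ge> 0" and C': "(C' \<longlongrightarrow> C) (at_right 0)"
  shows "((\<lambda>\<epsilon>. error_k S (\<delta> + \<epsilon>) (exact_kernel C \<eta> \<delta>) (approx_kernel (C' \<epsilon>) \<eta> \<delta> \<epsilon>)) \<longlongrightarrow> 0) (at_right 0)"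
proof -
  obtain H where H: "H \<ge> 0" "\<And>t. 0 \<le> t \<Longrightarrow> t \<le> 2 * \<delta> \<Longrightarrow> \<bar>\<eta> t\<bar> \<le> H"
    using smooth_profile_bounded[OF \<eta>] by blast
  define a where "a = (\<lambda>\<epsilon>. 6 * H * \<bar>C' \<epsilon> - C\<bar>)"
  define b where "b = 7 * C * H"
  define q where "q = (\<lambda>\<epsilon>. a \<epsilon> * measure lebesgue S
      + b * (unit_ball_vol DIM('a) * ((\<delta> + \<epsilon>) ^ DIM('a) - (\<delta> - \<epsilon>) ^ DIM('a))))"
  have \<epsilon>: "eventually (\<lambda>\<epsilon>. 0 < \<epsilon> \<and> \<epsilon> < \<delta>) (at_right 0)"
    using \<open>\<delta> > 0\<close> by (auto simp: eventually_at_right_field)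
  have d: "bounded_kernel (lebesgue_on S)
      (\<lambda>x y. approx_kernel (C' \<epsilon>) \<eta> \<delta> \<epsilon> x y - exact_kernel C \<eta> \<delta> x y)" if "\<epsilon> > 0" for \<epsilon>
    using that by (intro bounded_kernel_diff bounded_approx_kernel bounded_exact_kernel \<eta>)
  have "(a \<longlongrightarrow> 6 * H * \<bar>C - C\<bar>) (at_right 0)"
    unfolding a_def by (intro tendsto_intros C')
  then have a0: "(a \<longlongrightarrow> 0) (at_right 0)" by simp
  have "(q \<longlongrightarrow> 0 * measure lebesgue S
      + b * (unit_ball_vol DIM('a) * ((\<delta> + 0) ^ DIM('a) - (\<delta> - 0) ^ DIM('a)))) (at_right 0)"
    unfolding q_def by (intro tendsto_intros a0)
  then have q0: "(q \<longlongrightarrow> 0) (at_right 0)" by simp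
  have "((\<lambda>\<epsilon>. 2 * q \<epsilon> + 2 * sqrt ((a \<epsilon> + b) * q \<epsilon>) * sqrt (measure lebesgue S))
      \<longlongrightarrow> 2 * 0 + 2 * sqrt ((0 + b) * 0) * sqrt (measure lebesgue S)) (at_right 0)"
    by (intro tendsto_intros a0 q0)
  then have lim: "((\<lambda>\<epsilon>. 2 * q \<epsilon> + 2 * sqrt ((a \<epsilon> + b) * q \<epsilon>) * sqrt (measure lebesgue S)) \<longlongrightarrow> 0) (at_right 0)"
    by simp
  show ?thesis
  proof (rule tendsto_sandwich[OF _ _ tendsto_const lim])
    show "eventually (\<lambda>\<epsilon>. 0 \<le> error_k S (\<delta> + \<epsilon>) (exact_kernel C \<eta> \<delta>) (approx_kernel (C' \<epsilon>) \<eta> \<delta> \<epsilon>)) (at_right 0)"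
      using \<epsilon>
    proof eventually_elim
      case (elim \<epsilon>)
      then show ?case
        by (intro error_k_nonneg S d approx_kernel_eq_exact_kernel_far) auto
    qed
    show "eventually (\<lambda>\<epsilon>. error_k S (\<delta> + \<epsilon>) (exact_kernel C \<eta> \<delta>) (approx_kernel (C' \<epsilon>) \<eta> \<delta> \<epsilon>)
        \<le> 2 * q \<epsilon> + 2 * sqrt ((a \<epsilon> + b) * q \<epsilon>) * sqrt (measure lebesgue S)) (at_right 0)"
      using \<epsilon>
    proof eventually_elim
      case (elim \<epsilon>)
      then show ?case
        unfolding q_def using H \<open>C \<ge> 0\<close>
        by (intro error_k_le S d approx_kernel_eq_exact_kernel_far)
          (auto simp: a_def b_def intro!: kernel_difference_bound)
    qed
  qed
qed

theorem mainTheorem1: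
  fixes \<Omega> \<Gamma> S :: "(real ^ 'n) set"
    and \<delta> C\<^sub>\<delta> C\<^sub>e\<^sub>q :: real
    and C\<^sub>\<delta>\<^sub>\<epsilon> \<eta> :: "real \<Rightarrow> real"
    and \<gamma> :: "real ^ 'n \<Rightarrow> real ^ 'n \<Rightarrow> real"
    and \<gamma>\<^sub>\<epsilon> :: "real \<Rightarrow> real ^ 'n \<Rightarrow> real ^ 'n \<Rightarrow> real"
  assumes dim: "CARD('n) \<in> {1, 2, 3}"
    and Omega: "open \<Omega>" "bounded \<Omega>" "\<Omega> \<noteq> {}"
    and delta: "\<delta> > 0"
    and Gamma: "\<Gamma> = interaction_domain \<delta> \<Omega>"
    and S: "S = \<Omega> \<union> \<Gamma>"
    and profile: "smooth_profile \<eta>" "\<And>r. r \<ge> 0 \<Longrightarrow> \<eta> r \<ge> 0"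
    and scaling: "C\<^sub>\<delta> > 0" "(C\<^sub>\<delta>\<^sub>\<epsilon> \<longlongrightarrow> C\<^sub>\<delta>) (at_right 0)"
    and kernel: "\<gamma> = exact_kernel C\<^sub>\<delta> \<eta> \<delta>"
    and kernel_eps: "\<And>\<epsilon>. \<gamma>\<^sub>\<epsilon> \<epsilon> = approx_kernel (C\<^sub>\<delta>\<^sub>\<epsilon> \<epsilon>) \<eta> \<delta> \<epsilon>"
    and C_eq: "C\<^sub>e\<^sub>q > 0"
      "\<And>\<phi>. \<phi> \<in> constrained_space S \<Gamma> \<gamma> \<Longrightarrow>
            (L2_norm_on S \<phi>)\<^sup>2 \<le> C\<^sub>e\<^sub>q * (energy_norm S \<gamma> \<phi>)\<^sup>2"
  shows "(\<forall>\<epsilon> f g u u\<^sub>\<epsilon>.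
            0 < \<epsilon> \<and> \<epsilon> < \<delta> \<and>
            f \<in> dual_space S \<gamma> \<and> g \<in> trace_space S \<Gamma> \<gamma> \<and>
            weak_solution S \<Gamma> \<gamma> \<gamma> f g u \<and>
            weak_solution S \<Gamma> \<gamma> (\<gamma>\<^sub>\<epsilon> \<epsilon>) f g u\<^sub>\<epsilon> \<longrightarrow>
            L2_norm_on S (\<lambda>x. u x - u\<^sub>\<epsilon> x)
              \<le> C\<^sub>e\<^sub>q * error_k S (\<delta> + \<epsilon>) \<gamma> (\<gamma>\<^sub>\<epsilon> \<epsilon>) * L2_norm_on S u\<^sub>\<epsilon>)
       \<and> ((\<lambda>\<epsilon>. error_k S (\<delta> + \<epsilon>) \<gamma> (\<gamma>\<^sub>\<epsilon> \<epsilon>)) \<longlongrightarrow> 0) (at_right 0)"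
proof (intro conjI allI impI; (elim conjE)?)
  have S_eq: "S = (\<Union>x\<in>\<Omega>. \<Union>z\<in>cball 0 \<delta>. {x + z})"
    using neighbourhood_eq_sums[of \<delta> \<Omega>] delta by (simp add: S Gamma)
  have "open S" unfolding S_eq using Omega(1) by (intro open_sums) simp
  moreover have "bounded S"
    unfolding S_eq using bounded_sums[OF Omega(2) bounded_cball[of 0 \<delta>]] by (rule bounded_subset) auto
  ultimately have Sm: "S \<in> lmeasurable" by (intro lmeasurable_open)
  have Sne: "S \<noteq> {}" using Omega(3) S by simp
  show "((\<lambda>\<epsilon>. error_k S (\<delta> + \<epsilon>) \<gamma> (\<gamma>\<^sub>\<epsilon> \<epsilon>)) \<longlongrightarrow> 0) (at_right 0)"
    unfolding kernel kernel_eps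
    using scaling by (intro error_k_tendsto_0 Sm Sne profile delta) auto
  fix \<epsilon> f g u u\<^sub>\<epsilon>
  assume \<epsilon>: "0 < \<epsilon>" and sol: "weak_solution S \<Gamma> \<gamma> \<gamma> f g u" "weak_solution S \<Gamma> \<gamma> (\<gamma>\<^sub>\<epsilon> \<epsilon>) f g u\<^sub>\<epsilon>"
  show "L2_norm_on S (\<lambda>x. u x - u\<^sub>\<epsilon> x)
      \<le> C\<^sub>e\<^sub>q * error_k S (\<delta> + \<epsilon>) \<gamma> (\<gamma>\<^sub>\<epsilon> \<epsilon>) * L2_norm_on S u\<^sub>\<epsilon>"
  proof (rule weak_solution_kernel_perturbation[OF Sm Sne _ _ _ _ _ _ C_eq sol])
    show "bounded_kernel (lebesgue_on S) \<gamma>" "bounded_kernel (lebesgue_on S) (\<gamma>\<^sub>\<epsilon> \<epsilon>)"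
      unfolding kernel kernel_eps by (intro bounded_exact_kernel bounded_approx_kernel profile \<epsilon>)+
    show "\<gamma> x y = \<gamma> y x" "\<gamma>\<^sub>\<epsilon> \<epsilon> x y = \<gamma>\<^sub>\<epsilon> \<epsilon> y x" for x y
      by (simp_all add: kernel kernel_eps exact_kernel_radial approx_kernel_def norm_minus_commute)
    show "\<gamma> x y \<ge> 0" for x y
      using scaling(1) profile(2) by (simp add: kernel exact_kernel_def)
    show "\<gamma>\<^sub>\<epsilon> \<epsilon> x y = \<gamma> x y" if "\<delta> + \<epsilon> \<le> dist x y" for x y
      unfolding kernel kernel_eps by (rule approx_kernel_eq_exact_kernel_far[OF \<epsilon> that])
  qed
qed

end
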